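(* Let $X$ be a connected, locally path connected and paracompact space and $x\in X$. If $\pi_1^{sp}(X,x)=1$, then $\pi_1^{\tau}(X,x)$ is Hausdorff.
   Context: Paracompact spaces are understood to be Hausdorff, so that every open cover of a paracompact space is normal, i.e. admits a partition of unity subordinated to it. Spanier group: for an open cover $\mathcal{U}$ of $X$, $\pi(\mathcal{U},x)\le\pi_1(X,x)$ is the subgroup of classes having a representative of the form $\prod_{j=1}^n u_j v_j u_j^{-1}$, with $u_j$ a path starting at $x$ and $v_j$ a loop based at $u_j(1)$ lying inside some $U_j\in\mathcal{U}$. Then $\pi_1^{sp}(X,x)=\bigcap_{\mathcal{U}}\pi(\mathcal{U},x)$ over all open covers $\mathcal{U}$. $\pi_1^{qtop}(X,x)$ is the group $\pi_1(X,x)$ with the quotient topology induced by the natural map $\Omega(X,x)\to\pi_1(X,x)$ from the loop space with the compact-open topology. $\pi_1^{\tau}(X,x)$ (Brazas) is the group $\pi_1(X,x)$ with the finest topology that is coarser than (or equal to) the topology of $\pi_1^{qtop}(X,x)$ and makes $\pi_1(X,x)$ a topological group. *)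

theory Defs
  imports "HOL-Analysis.Analysis" "HOL-Algebra.Group"
begin

definition open_cover :: "'a topology \<Rightarrow> 'a set set \<Rightarrow> bool" where
  "open_cover X \<U> \<longleftrightarrow> (\<forall>U\<in>\<U>. openin X U) \<and> \<Union>\<U> = topspace X"

definition paracompact_space :: "'a topology \<Rightarrow> bool" where
  "paracompact_space X \<longleftrightarrow>
     Hausdorff_space X \<and>
     (\<forall>\<U>. open_cover X \<U> \<longrightarrow>
        (\<exists>\<V>. open_cover X \<V> \<and> locally_finite_in X \<V> \<and> (\<forall>V\<in>\<V>. \<exists>U\<in>\<U>. V \<subseteq> U)))"

(* Maps are taken extensional, i.e. undefined off topspace Y, so that each continuous map
   is represented by exactly one HOL function. *)
definition compact_open_topology :: "'b topology \<Rightarrow> 'a topology \<Rightarrow> ('b \<Rightarrow> 'a) topology" where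
  "compact_open_topology Y X =
     topology_generated_by
       {{f \<in> extensional (topspace Y). continuous_map Y X f \<and> f ` K \<subseteq> U} | K U.
          compactin Y K \<and> openin X U}"

definition quotient_topology :: "'a topology \<Rightarrow> ('a \<Rightarrow> 'b) \<Rightarrow> 'b topology" where
  "quotient_topology T f =
     topology (\<lambda>W. W \<subseteq> f ` topspace T \<and> openin T {p \<in> topspace T. f p \<in> W})"

definition unit_interval_topology :: "real topology" where
  "unit_interval_topology = top_of_set {0..1}"

(* joinpaths and reversepath of the library require the type class topological_space,
   so they do not apply to the values of an abstract topology. *)
definition path_prod :: "(real \<Rightarrow> 'a) \<Rightarrow> (real \<Rightarrow> 'a) \<Rightarrow> real \<Rightarrow> 'a" where
  "path_prod p q = (\<lambda>t\<in>{0..1}. if t \<le> 1/2 then p (2 * t) else q (2 * t - 1))"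

definition path_rev :: "(real \<Rightarrow> 'a) \<Rightarrow> real \<Rightarrow> 'a" where
  "path_rev p = (\<lambda>t\<in>{0..1}. p (1 - t))"

definition const_path :: "'a \<Rightarrow> real \<Rightarrow> 'a" where
  "const_path x = (\<lambda>t\<in>{0..1}. x)"

definition loops :: "'a topology \<Rightarrow> 'a \<Rightarrow> (real \<Rightarrow> 'a) set" where
  "loops X x = {p \<in> extensional {0..1}. pathin X p \<and> p 0 = x \<and> p 1 = x}"

definition loop_space :: "'a topology \<Rightarrow> 'a \<Rightarrow> (real \<Rightarrow> 'a) topology" where
  "loop_space X x =
     subtopology (compact_open_topology unit_interval_topology X) (loops X x)"

definition loop_homotopy :: "'a topology \<Rightarrow> 'a \<Rightarrow> ((real \<Rightarrow> 'a) \<times> (real \<Rightarrow> 'a)) set" where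
  "loop_homotopy X x =
     {(p, q). p \<in> loops X x \<and> q \<in> loops X x \<and>
        homotopic_with (\<lambda>r. r 0 = x \<and> r 1 = x) unit_interval_topology X p q}"

definition loop_class :: "'a topology \<Rightarrow> 'a \<Rightarrow> (real \<Rightarrow> 'a) \<Rightarrow> (real \<Rightarrow> 'a) set" where
  "loop_class X x p = loop_homotopy X x `` {p}"

definition fundamental_group :: "'a topology \<Rightarrow> 'a \<Rightarrow> (real \<Rightarrow> 'a) set monoid" where
  "fundamental_group X x =
     \<lparr>carrier = loops X x // loop_homotopy X x,
      mult = (\<lambda>A B. \<Union>p\<in>A. \<Union>q\<in>B. loop_class X x (path_prod p q)),
      one = loop_class X x (const_path x)\<rparr>"

(* The loop (u1 v1 u1^-1) ((u2 v2 u2^-1) (... c)), where c is the constant loop at x. *)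
definition spanier_loop :: "'a \<Rightarrow> ((real \<Rightarrow> 'a) \<times> (real \<Rightarrow> 'a)) list \<Rightarrow> real \<Rightarrow> 'a" where
  "spanier_loop x ws =
     foldr (\<lambda>(u, v) r. path_prod (path_prod (path_prod u v) (path_rev u)) r) ws (const_path x)"

definition spanier_group_of_cover ::
    "'a topology \<Rightarrow> 'a set set \<Rightarrow> 'a \<Rightarrow> (real \<Rightarrow> 'a) set set" where
  "spanier_group_of_cover X \<U> x =
     {A \<in> carrier (fundamental_group X x).
        \<exists>ws. (\<forall>(u, v)\<in>set ws.
                 pathin X u \<and> u 0 = x \<and>
                 pathin X v \<and> v 0 = u 1 \<and> v 1 = u 1 \<and>
                 (\<exists>U\<in>\<U>. v ` {0..1} \<subseteq> U)) \<and>
              spanier_loop x ws \<in> A}"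

definition spanier_group :: "'a topology \<Rightarrow> 'a \<Rightarrow> (real \<Rightarrow> 'a) set set" where
  "spanier_group X x = (\<Inter>\<U>\<in>{\<U>. open_cover X \<U>}. spanier_group_of_cover X \<U> x)"

definition pi1_qtop :: "'a topology \<Rightarrow> 'a \<Rightarrow> (real \<Rightarrow> 'a) set topology" where
  "pi1_qtop X x = quotient_topology (loop_space X x) (loop_class X x)"

(* No separation axiom is part of the notion of a topological group. *)
definition topological_group :: "('g, 'm) monoid_scheme \<Rightarrow> 'g topology \<Rightarrow> bool" where
  "topological_group G T \<longleftrightarrow>
     group G \<and> topspace T = carrier G \<and>
     continuous_map (prod_topology T T) T (\<lambda>(a, b). a \<otimes>\<^bsub>G\<^esub> b) \<and>
     continuous_map T T (\<lambda>a. inv\<^bsub>G\<^esub> a)"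

definition coarser_topology :: "'a topology \<Rightarrow> 'a topology \<Rightarrow> bool" where
  "coarser_topology S T \<longleftrightarrow>
     topspace S = topspace T \<and> (\<forall>U. openin S U \<longrightarrow> openin T U)"

definition is_finest_group_topology ::
    "('g, 'm) monoid_scheme \<Rightarrow> 'g topology \<Rightarrow> 'g topology \<Rightarrow> bool" where
  "is_finest_group_topology G Q T \<longleftrightarrow>
     topological_group G T \<and> coarser_topology T Q \<and>
     (\<forall>S. topological_group G S \<and> coarser_topology S Q \<longrightarrow> coarser_topology S T)"

definition finest_group_topology ::
    "('g, 'm) monoid_scheme \<Rightarrow> 'g topology \<Rightarrow> 'g topology" where
  "finest_group_topology G Q = (THE T. is_finest_group_topology G Q T)"

definition pi1_tau :: "'a topology \<Rightarrow> 'a \<Rightarrow> (real \<Rightarrow> 'a) set topology" where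
  "pi1_tau X x = finest_group_topology (fundamental_group X x) (pi1_qtop X x)"

lemma openin_quotient_topology:
  "openin (quotient_topology T f) W \<longleftrightarrow>
     W \<subseteq> f ` topspace T \<and> openin T {p \<in> topspace T. f p \<in> W}"
proof -
  have "istopology (\<lambda>W. W \<subseteq> f ` topspace T \<and> openin T {p \<in> topspace T. f p \<in> W})"
    unfolding istopology_def
  proof (intro conjI allI impI)
    fix A B
    assume "A \<subseteq> f ` topspace T \<and> openin T {p \<in> topspace T. f p \<in> A}"
      "B \<subseteq> f ` topspace T \<and> openin T {p \<in> topspace T. f p \<in> B}"
    moreover have "{p \<in> topspace T. f p \<in> A \<inter> B} =
        {p \<in> topspace T. f p \<in> A} \<inter> {p \<in> topspace T. f p \<in> B}"
      by auto
    ultimately show "A \<inter> B \<subseteq> f ` topspace T" "openin T {p \<in> topspace T. f p \<in> A \<inter> B}"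
      by auto
  next
    fix \<K>
    assume \<K>: "\<forall>A\<in>\<K>. A \<subseteq> f ` topspace T \<and> openin T {p \<in> topspace T. f p \<in> A}"
    then show "\<Union>\<K> \<subseteq> f ` topspace T" by blast
    have "{p \<in> topspace T. f p \<in> \<Union>\<K>} = (\<Union>A\<in>\<K>. {p \<in> topspace T. f p \<in> A})"
      by auto
    with \<K> show "openin T {p \<in> topspace T. f p \<in> \<Union>\<K>}" by auto
  qed
  then show ?thesis
    unfolding quotient_topology_def by (simp only: topology_inverse')
qed

lemma topspace_quotient_topology: "topspace (quotient_topology T f) = f ` topspace T"
proof
  show "topspace (quotient_topology T f) \<subseteq> f ` topspace T"
    using iffD1[OF openin_quotient_topology openin_topspace] by (rule conjunct1)
  have "{p \<in> topspace T. f p \<in> f ` topspace T} = topspace T" by auto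
  then have "openin (quotient_topology T f) (f ` topspace T)"
    by (simp add: openin_quotient_topology)
  then show "f ` topspace T \<subseteq> topspace (quotient_topology T f)"
    by (rule openin_subset)
qed

lemma topspace_compact_open_topology:
  "topspace (compact_open_topology Y X) = {f \<in> extensional (topspace Y). continuous_map Y X f}"
  (is "_ = ?C")
proof
  show "topspace (compact_open_topology Y X) \<subseteq> ?C"
    by (auto simp: compact_open_topology_def)
  have "?C \<in> {{f \<in> extensional (topspace Y). continuous_map Y X f \<and> f ` K \<subseteq> U} | K U.
          compactin Y K \<and> openin X U}"
    by (rule CollectI, rule exI[of _ "{}"], rule exI[of _ "{}"]) auto
  then show "?C \<subseteq> topspace (compact_open_topology Y X)"
    unfolding compact_open_topology_def by (simp only: topology_generated_by_topspace) blast
qed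

lemma topspace_loop_space: "topspace (loop_space X x) = loops X x"
proof -
  have "loops X x \<subseteq> {f \<in> extensional (topspace unit_interval_topology).
      continuous_map unit_interval_topology X f}"
    unfolding loops_def pathin_def unit_interval_topology_def by simp blast
  then show ?thesis
    unfolding loop_space_def topspace_subtopology topspace_compact_open_topology by blast
qed

lemma topspace_pi1_qtop: "topspace (pi1_qtop X x) = carrier (fundamental_group X x)"
  unfolding pi1_qtop_def topspace_quotient_topology topspace_loop_space
    fundamental_group_def quotient_def loop_class_def by (simp add: UNION_singleton_eq_range)

(* The supremum of all group topologies coarser than Q is again one of them. *)
lemma ex1_finest_group_topology:
  fixes G (structure)
  assumes "group G" and Q: "topspace Q = carrier G"
  shows "\<exists>!T. is_finest_group_topology G Q T"
proof -
  interpret group G by fact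
  define F where "F = {S. topological_group G S \<and> coarser_topology S Q}"
  define \<B> where "\<B> = insert (carrier G) {U. \<exists>S\<in>F. openin S U}"
  define T where "T = topology_generated_by \<B>"
  have F_sub: "U \<subseteq> carrier G" if "S \<in> F" "openin S U" for S U
    using that openin_subset by (fastforce simp: F_def topological_group_def)
  have "\<Union>\<B> = carrier G"
    using F_sub by (auto simp: \<B>_def)
  then have topT: "topspace T = carrier G"
    by (simp add: T_def)
  have F_le: "openin T U" if "S \<in> F" "openin S U" for S U
    unfolding T_def by (rule topology_generated_by_Basis) (use that in \<open>auto simp: \<B>_def\<close>)
  have T_Q: "openin Q U" if "openin T U" for U
  proof -
    have "generate_topology_on \<B> U"
      using that by (simp add: T_def openin_topology_generated_by_iff)
    moreover have "openin Q s" if "s \<in> \<B>" for s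
      using that Q openin_topspace[of Q] by (auto simp: \<B>_def F_def coarser_topology_def)
    ultimately show ?thesis
      using generate_topology_on_coarsest[of "openin Q" \<B> U] openin_topology_generated_by_iff
      by (metis istopology_openin)
  qed
  have into_T: "continuous_map P T f"
    if f: "f ` topspace P \<subseteq> carrier G"
      and op: "\<And>S U. S \<in> F \<Longrightarrow> openin S U \<Longrightarrow> openin P (f -` U \<inter> topspace P)"
    for P :: "'c topology" and f
    unfolding T_def
  proof (rule continuous_on_generated_topo)
    fix U assume "U \<in> \<B>"
    then consider "U = carrier G" | S where "S \<in> F" "openin S U"
      by (auto simp: \<B>_def)
    then show "openin P (f -` U \<inter> topspace P)"
    proof cases
      case 1
      then have "f -` U \<inter> topspace P = topspace P" using f by auto
      then show ?thesis by simp
    qed (rule op)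
  qed (use f \<open>\<Union>\<B> = carrier G\<close> in auto)
  have id_T: "continuous_map T S id" if S: "S \<in> F" for S
  proof -
    have "topspace S = carrier G"
      using S by (simp add: F_def topological_group_def)
    moreover have "{a \<in> topspace T. id a \<in> U} = U" if "openin S U" for U
      using F_sub[OF S that] topT by auto
    ultimately show ?thesis
      using F_le[OF S] topT by (simp add: continuous_map_def)
  qed
  have mult: "continuous_map (prod_topology T T) T (\<lambda>(a, b). a \<otimes> b)"
  proof (rule into_T)
    fix S U assume S: "S \<in> F" and U: "openin S U"
    have "continuous_map (prod_topology T T) (prod_topology S S) (\<lambda>(a, b). (id a, id b))"
      using id_T[OF S] by (simp only: continuous_map_prod_top) simp
    moreover have "continuous_map (prod_topology S S) S (\<lambda>(a, b). a \<otimes> b)"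
      using S by (simp add: F_def topological_group_def)
    ultimately have "continuous_map (prod_topology T T) S
        ((\<lambda>(a, b). a \<otimes> b) \<circ> (\<lambda>(a, b). (id a, id b)))"
      by (rule continuous_map_compose)
    then have "openin (prod_topology T T)
        {z \<in> topspace (prod_topology T T). (case z of (a, b) \<Rightarrow> a \<otimes> b) \<in> U}"
      using U by (auto dest!: openin_continuous_map_preimage simp: case_prod_unfold o_def)
    then show "openin (prod_topology T T)
        ((\<lambda>(a, b). a \<otimes> b) -` U \<inter> topspace (prod_topology T T))"
      by (simp add: vimage_def Int_def conj_commute)
  qed (auto simp: topT)
  have invs: "continuous_map T T (\<lambda>a. inv a)"
  proof (rule into_T)
    fix S U assume S: "S \<in> F" and U: "openin S U"
    then have "continuous_map T S ((\<lambda>a. inv a) \<circ> id)"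
      by (intro continuous_map_compose[OF id_T]) (auto simp: F_def topological_group_def)
    then have "openin T {z \<in> topspace T. inv z \<in> U}"
      using U by (auto dest!: openin_continuous_map_preimage)
    then show "openin T ((\<lambda>a. inv a) -` U \<inter> topspace T)"
      by (simp add: vimage_def Int_def conj_commute)
  qed (auto simp: topT)
  have "is_finest_group_topology G Q T"
    using mult invs \<open>group G\<close> topT Q T_Q F_le
    by (auto simp: is_finest_group_topology_def topological_group_def coarser_topology_def F_def)
  moreover have "S = S'"
    if S: "is_finest_group_topology G Q S" and S': "is_finest_group_topology G Q S'" for S S'
  proof -
    have "coarser_topology S S'" "coarser_topology S' S"
      using S S' unfolding is_finest_group_topology_def by simp_all
    then show ?thesis
      by (auto simp: coarser_topology_def topology_eq)
  qed
  ultimately show ?thesis by (intro ex_ex1I[OF exI])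
qed

end

(*
Fix an open cover U and let N be the normal subgroup of pi_1(X,x) generated by the classes of the
loops u v u^-1 with v inside a member of U; it lies in the Spanier group of U. If two loops p, q
are close in the compact-open topology, then on each piece of a fine subdivision they run inside
one member of U, and by local path connectedness p(t_i) and q(t_i) are joined inside a small set;
the resulting ladder writes [p][q]^-1 as an element of N. Hence the map from loops to cosets of N
is locally constant, and the topology of unions of cosets of N is a group topology coarser than
that of pi_1^qtop, so coarser than pi_1^tau. If a and b are distinct, then a b^-1 is outside the
Spanier group of some U, and the cosets N a and N b separate them.
*)
theory Submission
  imports Defs "HOL-Algebra.Generated_Groups"
begin

subsection \<open>Homotopy of paths in an abstract topology\<close>

text \<open>Sets that are open in the quotient topology need not be open in pi_1^tau, so separating
  points in pi_1^qtop would not suffice. What transfers is a group topology coarser than the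
  quotient topology, since pi_1^tau is the finest of these. Pulling back the discrete topology along
  the quotient by a normal subgroup always gives a group topology, so the topological burden is
  local constancy of cosets along loops. Initial segments of two nearby loops end at different
  points and cannot be compared directly. A rung closes the gap, and the comparison is a relation
  between paths from x with a common endpoint, not between loops. Each rung has to lie in both cells
  that it borders, which is why it is sought in the intersection of two members of the cover.
  Normality of N is a check on its generators; its inclusion in the Spanier group of U is what turns
  an element missing from that group into two distinct cosets.\<close>

definition path_homotopic :: "'a topology \<Rightarrow> (real \<Rightarrow> 'a) \<Rightarrow> (real \<Rightarrow> 'a) \<Rightarrow> bool" where
  "path_homotopic X p q \<longleftrightarrow>
     homotopic_with (\<lambda>r. r 0 = p 0 \<and> r 1 = p 1) (top_of_set {0..1}) X p q"

text \<open>The endpoint condition names only \<open>p\<close>, but it holds at every stage of the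
  homotopy, hence at its end \<open>q\<close>.\<close>

lemma path_homotopic_ends:
  assumes "path_homotopic X p q"
  shows "pathin X p" "pathin X q" "q 0 = p 0" "q 1 = p 1"
  using homotopic_with_imp_property[OF assms[unfolded path_homotopic_def]]
    homotopic_with_imp_continuous_maps[OF assms[unfolded path_homotopic_def]]
  by (auto simp: pathin_def)

lemma path_homotopic_refl: "pathin X p \<Longrightarrow> path_homotopic X p p"
  by (simp add: path_homotopic_def pathin_def)

lemma path_homotopic_sym: "path_homotopic X p q \<Longrightarrow> path_homotopic X q p"
  using path_homotopic_ends[of X p q]
  by (auto simp: path_homotopic_def intro: homotopic_with_symD)

lemma path_homotopic_trans [trans]:
  "path_homotopic X p q \<Longrightarrow> path_homotopic X q r \<Longrightarrow> path_homotopic X p r"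
  using path_homotopic_ends[of X p q] by (auto simp: path_homotopic_def intro: homotopic_with_trans)

text \<open>Products and reverses are cut off outside \<open>{0..1}\<close> while composites with
  real maps are not, so identities between them hold on the interval only. This lemma carries
  homotopies across such identities.\<close>

lemma path_homotopic_cong:
  assumes "path_homotopic X p q"
    and "\<And>t. t \<in> {0..1} \<Longrightarrow> p' t = p t" "\<And>t. t \<in> {0..1} \<Longrightarrow> q' t = q t"
  shows "path_homotopic X p' q'"
proof -
  have "p' 0 = p 0" "p' 1 = p 1" using assms(2) by auto
  then show ?thesis
    unfolding path_homotopic_def
    by (simp, intro homotopic_with_eq[OF assms(1)[unfolded path_homotopic_def]])
      (use assms in auto)
qed

lemma path_homotopic_eqI:
  assumes "pathin X p" "\<And>t. t \<in> {0..1} \<Longrightarrow> q t = p t"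
  shows "path_homotopic X p q"
  by (rule path_homotopic_cong[OF path_homotopic_refl]) (use assms in auto)

lemma pathin_cong: "pathin X p \<Longrightarrow> (\<And>t. t \<in> {0..1} \<Longrightarrow> q t = p t) \<Longrightarrow> pathin X q"
  using path_homotopic_ends(2) path_homotopic_eqI by metis

section \<open>Homotopies obtained by reparametrising a path\<close>

lemma path_homotopic_compose:
  assumes "pathin X p" "homotopic_paths {0..1} f g"
  shows "path_homotopic X (p \<circ> f) (p \<circ> g)"
  unfolding path_homotopic_def
  by (rule homotopic_with_compose_continuous_map_left
      [OF assms(2)[unfolded homotopic_paths_def]])
    (use assms in \<open>auto simp: pathin_def pathstart_def pathfinish_def\<close>)

text \<open>\<open>{0..1}\<close> is convex, so the straight-line homotopy from \<open>f\<close> to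
  \<open>g\<close> stays in it, and composing with \<open>p\<close> moves it to X. Associativity,
  units and inverses all come from this.\<close>

lemma path_homotopic_reparam:
  assumes "pathin X p" "path f" "path g" "path_image f \<subseteq> {0..1}" "path_image g \<subseteq> {0..1}"
    "pathstart f = pathstart g" "pathfinish f = pathfinish g"
  shows "path_homotopic X (p \<circ> f) (p \<circ> g)"
proof (rule path_homotopic_compose[OF assms(1) homotopic_paths_linear])
  show "closed_segment (f t) (g t) \<subseteq> {0..1}" if "t \<in> {0..1}" for t
    using that assms(4,5) by (intro closed_segment_subset) (auto simp: path_image_def image_subset_iff)
qed (use assms in auto)

section \<open>Products and reverses of paths\<close>

lemma path_prod_ends [simp]: "path_prod p q 0 = p 0" "path_prod p q 1 = q 1"
  by (auto simp: path_prod_def)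

lemma path_rev_ends [simp]: "path_rev p 0 = p 1" "path_rev p 1 = p 0"
  by (auto simp: path_rev_def)

lemma const_path_ends [simp]: "const_path x 0 = x" "const_path x 1 = x"
  by (auto simp: const_path_def)

lemma pathin_const_path [simp]: "pathin X (const_path x) \<longleftrightarrow> x \<in> topspace X"
proof -
  have "pathin X (const_path x) \<longleftrightarrow> pathin X (\<lambda>t. x)"
    by (rule iffI; erule pathin_cong) (simp_all add: const_path_def)
  then show ?thesis by (simp add: pathin_const)
qed

lemma pathin_path_rev:
  assumes "pathin X p" shows "pathin X (path_rev p)"
proof -
  have "pathin X (p \<circ> (\<lambda>t. 1 - t))"
    unfolding pathin_def
    by (rule continuous_map_compose[OF _ assms[unfolded pathin_def]])
      (auto intro!: continuous_intros)
  then show ?thesis by (rule pathin_cong) (auto simp: path_rev_def)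
qed

text \<open>The homotopies are pasted along the line where the path parameter \<open>snd z\<close>
  is 1/2. Both equal \<open>b\<close> there, because every stage of either homotopy keeps its
  ends.\<close>

lemma homotopic_with_path_prod:
  fixes p q :: "real \<Rightarrow> 'a"
  assumes p: "homotopic_with (\<lambda>r. r 0 = a \<and> r 1 = b) (top_of_set {0..1}) X p p'"
    and q: "homotopic_with (\<lambda>r. r 0 = b \<and> r 1 = c) (top_of_set {0..1}) X q q'"
  shows "homotopic_with (\<lambda>r. r 0 = a \<and> r 1 = c) (top_of_set {0..1}) X
           (path_prod p q) (path_prod p' q')"
proof -
  let ?I = "top_of_set {0..1::real}"
  obtain h where h: "continuous_map (prod_topology ?I ?I) X h"
    "\<forall>t\<in>{0..1}. h (0, t) = p t" "\<forall>t\<in>{0..1}. h (1, t) = p' t"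
    "\<forall>s\<in>{0..1}. h (s, 0) = a \<and> h (s, 1) = b"
    using p by (subst (asm) homotopic_with) auto
  obtain k where k: "continuous_map (prod_topology ?I ?I) X k"
    "\<forall>t\<in>{0..1}. k (0, t) = q t" "\<forall>t\<in>{0..1}. k (1, t) = q' t"
    "\<forall>s\<in>{0..1}. k (s, 0) = b \<and> k (s, 1) = c"
    using q by (subst (asm) homotopic_with) auto
  define H where "H = (\<lambda>z::real\<times>real. if snd z \<le> 1/2 then (h \<circ> (\<lambda>z. (fst z, 2 * snd z))) z
      else (k \<circ> (\<lambda>z. (fst z, 2 * snd z - 1))) z)"
  let ?P = "prod_topology ?I ?I"
  have P: "?P = top_of_set ({0..1} \<times> {0..1})"
    by (rule prod_topology_subtopology_eu)
  have "continuous_map ?P X H"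
    unfolding H_def
  proof (rule continuous_map_cases_le)
    show "continuous_map (subtopology ?P {z \<in> topspace ?P. snd z \<le> 1/2}) X
        (h \<circ> (\<lambda>z. (fst z, 2 * snd z)))"
      by (rule continuous_map_compose[OF _ h(1)], unfold P)
        (auto simp: subtopology_subtopology intro!: continuous_intros)
    show "continuous_map (subtopology ?P {z \<in> topspace ?P. 1/2 \<le> snd z}) X
        (k \<circ> (\<lambda>z. (fst z, 2 * snd z - 1)))"
      by (rule continuous_map_compose[OF _ k(1)], unfold P)
        (auto simp: subtopology_subtopology intro!: continuous_intros)
    show "continuous_map ?P euclideanreal snd"
      by (simp add: P continuous_on_snd)
    fix z assume "z \<in> topspace ?P" and eq: "snd z = 1/2"
    then have "2 * snd z = 1" "fst z \<in> {0..1}" by auto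
    then show "(h \<circ> (\<lambda>z. (fst z, 2 * snd z))) z = (k \<circ> (\<lambda>z. (fst z, 2 * snd z - 1))) z"
      using h(4) k(4) by simp
  qed auto
  then show ?thesis
    by (subst homotopic_with) (use h(2-) k(2-) in \<open>auto simp: H_def path_prod_def intro!: exI[of _ H]\<close>)
qed

lemma path_homotopic_prod:
  assumes "path_homotopic X p p'" "path_homotopic X q q'" "p 1 = q 0"
  shows "path_homotopic X (path_prod p q) (path_prod p' q')"
  using homotopic_with_path_prod assms by (auto simp: path_homotopic_def)

text \<open>Apply the product of homotopies to constant ones; the pasting argument is then made only
  once.\<close>

lemma pathin_path_prod:
  "pathin X p \<Longrightarrow> pathin X q \<Longrightarrow> p 1 = q 0 \<Longrightarrow> pathin X (path_prod p q)"
  by (meson path_homotopic_ends(1) path_homotopic_prod path_homotopic_refl)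

lemma path_homotopic_rev:
  assumes "path_homotopic X p q"
  shows "path_homotopic X (path_rev p) (path_rev q)"
proof -
  have "path_homotopic X (p \<circ> (\<lambda>t. 1 - t)) (q \<circ> (\<lambda>t. 1 - t))"
    unfolding path_homotopic_def
    by (rule homotopic_with_compose_continuous_map_right[OF assms[unfolded path_homotopic_def]])
      (auto intro!: continuous_intros)
  then show ?thesis by (rule path_homotopic_cong) (auto simp: path_rev_def)
qed

text \<open>No order of \<open>a\<close> and \<open>b\<close> is imposed: \<open>a > b\<close> runs
  backwards and \<open>a = b\<close> is constant. Reverses and constant paths are therefore subpaths
  too.\<close>

definition subpath_in :: "(real \<Rightarrow> 'a) \<Rightarrow> real \<Rightarrow> real \<Rightarrow> real \<Rightarrow> 'a" where
  "subpath_in p a b = p \<circ> linepath a b"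

lemma subpath_in_ends [simp]: "subpath_in p a b 0 = p a" "subpath_in p a b 1 = p b"
  by (auto simp: subpath_in_def linepath_def)

lemma linepath_I: "a \<in> {0..1::real} \<Longrightarrow> b \<in> {0..1} \<Longrightarrow> path_image (linepath a b) \<subseteq> {0..1}"
  by (simp add: closed_segment_subset)

lemma pathin_subpath_in:
  assumes "pathin X p" "a \<in> {0..1}" "b \<in> {0..1}"
  shows "pathin X (subpath_in p a b)"
  unfolding subpath_in_def
  by (rule path_homotopic_ends(1)[OF path_homotopic_reparam[OF assms(1)]])
     (use linepath_I[OF assms(2,3)] in auto)

lemma path_prod_compose:
  "t \<in> {0..1} \<Longrightarrow> path_prod (p \<circ> f) (p \<circ> g) t = (p \<circ> (f +++ g)) t"
  by (simp add: path_prod_def joinpaths_def)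

text \<open>The triples (0,0,1), (0,1,1) and (0,1,0) for (a,b,c) give the left unit, the right unit
  and the inverse law.\<close>

lemma path_homotopic_subpath_in_join:
  assumes "pathin X p" "a \<in> {0..1}" "b \<in> {0..1}" "c \<in> {0..1}"
  shows "path_homotopic X (path_prod (subpath_in p a b) (subpath_in p b c)) (subpath_in p a c)"
proof -
  have "path_homotopic X (p \<circ> (linepath a b +++ linepath b c)) (p \<circ> linepath a c)"
    by (rule path_homotopic_reparam[OF assms(1)])
      (use linepath_I assms in \<open>auto simp: path_image_join\<close>)
  then show ?thesis
    by (rule path_homotopic_cong) (auto simp: subpath_in_def path_prod_compose)
qed

lemma path_homotopic_subpath_in_trivial:
  assumes "pathin X p" shows "path_homotopic X (subpath_in p 0 1) p"
  by (rule path_homotopic_sym[OF path_homotopic_eqI]) (use assms in \<open>auto simp: subpath_in_def linepath_def\<close>)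

lemma path_homotopic_const_left:
  assumes "pathin X p" "x = p 0"
  shows "path_homotopic X (path_prod (const_path x) p) p"
proof -
  have "path_homotopic X (path_prod (subpath_in p 0 0) (subpath_in p 0 1)) (subpath_in p 0 1)"
    by (rule path_homotopic_subpath_in_join) (use assms in auto)
  then show ?thesis
    by (rule path_homotopic_cong) (auto simp: path_prod_def subpath_in_def linepath_def const_path_def assms(2))
qed

lemma path_homotopic_const_right:
  assumes "pathin X p" "x = p 1"
  shows "path_homotopic X (path_prod p (const_path x)) p"
proof -
  have "path_homotopic X (path_prod (subpath_in p 0 1) (subpath_in p 1 1)) (subpath_in p 0 1)"
    by (rule path_homotopic_subpath_in_join) (use assms in auto)
  then show ?thesis
    by (rule path_homotopic_cong) (auto simp: path_prod_def subpath_in_def linepath_def const_path_def assms(2))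
qed

lemma path_homotopic_rev_right:
  assumes "pathin X p"
  shows "path_homotopic X (path_prod p (path_rev p)) (const_path (p 0))"
proof -
  have "path_homotopic X (path_prod (subpath_in p 0 1) (subpath_in p 1 0)) (subpath_in p 0 0)"
    by (rule path_homotopic_subpath_in_join) (use assms in auto)
  then show ?thesis
    by (rule path_homotopic_cong) (auto simp: path_prod_def subpath_in_def linepath_def const_path_def path_rev_def)
qed

lemma path_rev_rev: "t \<in> {0..1} \<Longrightarrow> path_rev (path_rev p) t = p t"
  by (simp add: path_rev_def)

text \<open>An equality of functions, since both sides are undefined off the interval. The two case
  splits disagree only at t = 1/2, where the left side is \<open>p 1\<close> and the right side
  \<open>q 0\<close>.\<close>

lemma path_rev_prod:
  assumes "p 1 = q 0"
  shows "path_rev (path_prod p q) = path_prod (path_rev q) (path_rev p)"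
proof
  show "path_rev (path_prod p q) t = path_prod (path_rev q) (path_rev p) t" for t
  proof (cases "t = 1/2")
    case True
    show ?thesis unfolding True using assms by (simp add: path_prod_def path_rev_def)
  next
    case False
    then show ?thesis by (auto simp: path_prod_def path_rev_def algebra_simps)
  qed
qed

lemma path_homotopic_rev_left:
  assumes "pathin X p"
  shows "path_homotopic X (path_prod (path_rev p) p) (const_path (p 1))"
proof -
  have "path_homotopic X (path_prod (path_rev p) (path_rev (path_rev p))) (const_path (p 1))"
    using path_homotopic_rev_right[OF pathin_path_rev[OF assms]] by simp
  then show ?thesis
    by (rule path_homotopic_cong) (auto simp: path_prod_def path_rev_def)
qed

lemma path_homotopic_assoc:
  assumes "pathin X p" "pathin X q" "pathin X r" "p 1 = q 0" "q 1 = r 0"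
  shows "path_homotopic X (path_prod (path_prod p q) r) (path_prod p (path_prod q r))"
proof -
  let ?w = "path_prod p (path_prod q r)"
  \<comment> \<open>With slopes 2, 1 and 1/2 this sends the breakpoints 1/4 and 1/2 of
    \<open>(p q) r\<close> to the breakpoints 1/2 and 3/4 of \<open>p (q r)\<close>, so
    \<open>?w\<close> after \<open>?f\<close> is \<open>(p q) r\<close>.\<close>
  let ?f = "(linepath 0 (1/2) +++ linepath (1/2) (3/4)) +++ linepath (3/4) (1::real)"
  have w: "pathin X ?w" using assms by (intro pathin_path_prod) auto
  have "path_homotopic X (?w \<circ> ?f) (?w \<circ> linepath 0 1)"
  proof (rule path_homotopic_reparam[OF w])
    show "path_image ?f \<subseteq> {0..1}"
      by (intro subset_path_image_join linepath_I) auto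
  qed (use linepath_I in auto)
  moreover have "?f t = (if t \<le> 1/4 then 2 * t else if t \<le> 1/2 then t + 1/4 else t / 2 + 1/2)" for t
    by (auto simp: joinpaths_def linepath_def field_simps)
  ultimately show ?thesis
    by (elim path_homotopic_cong) (auto simp: path_prod_def linepath_def algebra_simps)
qed

text \<open>This bracketing is the one that arises when \<open>p q^-1\<close> meets
  \<open>q r^-1\<close>, or when a common tail meets its reverse; the next two lemmas are these
  cases.\<close>

lemma path_homotopic_prod_cancel:
  assumes "pathin X p" "pathin X q" "pathin X q'" "pathin X r"
    and "p 1 = q 0" "q 1 = q' 0" "q' 1 = r 0"
    and qq': "path_homotopic X (path_prod q q') (const_path (p 1))"
  shows "path_homotopic X (path_prod (path_prod p q) (path_prod q' r)) (path_prod p r)"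
proof -
  have r0: "r 0 = p 1"
    using path_homotopic_ends(4)[OF qq'] assms(7) by simp
  note [simp] = assms(1-7) pathin_path_prod path_homotopic_refl
  have "path_homotopic X (path_prod (path_prod p q) (path_prod q' r))
      (path_prod (path_prod (path_prod p q) q') r)"
    by (intro path_homotopic_sym[OF path_homotopic_assoc]) simp_all
  also have "path_homotopic X \<dots> (path_prod (path_prod p (path_prod q q')) r)"
    by (intro path_homotopic_prod path_homotopic_assoc) simp_all
  also have "path_homotopic X \<dots> (path_prod (path_prod p (const_path (p 1))) r)"
    by (intro path_homotopic_prod qq') simp_all
  also have "path_homotopic X \<dots> (path_prod p r)"
    by (intro path_homotopic_prod path_homotopic_const_right) (simp_all add: r0)
  finally show ?thesis .
qed

lemma path_homotopic_prod_cancel_rev: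
  assumes "pathin X p" "pathin X q" "pathin X r" "p 1 = q 0" "r 0 = q 0"
  shows "path_homotopic X (path_prod (path_prod p q) (path_prod (path_rev q) r)) (path_prod p r)"
  using assms path_homotopic_rev_right[of X q]
  by (intro path_homotopic_prod_cancel pathin_path_rev) auto

lemma path_homotopic_prod_rev_cancel:
  assumes "pathin X p" "pathin X q" "pathin X r" "p 1 = q 1" "r 0 = q 1"
  shows "path_homotopic X (path_prod (path_prod p (path_rev q)) (path_prod q r)) (path_prod p r)"
  using assms path_homotopic_rev_left[of X q]
  by (intro path_homotopic_prod_cancel pathin_path_rev) auto

subsection \<open>The fundamental group\<close>

lemma in_loops_iff: "p \<in> loops X x \<longleftrightarrow> p \<in> extensional {0..1} \<and> pathin X p \<and> p 0 = x \<and> p 1 = x"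
  by (simp add: loops_def)

lemma loop_homotopy_iff:
  "(p, q) \<in> loop_homotopy X x \<longleftrightarrow> p \<in> loops X x \<and> q \<in> loops X x \<and> path_homotopic X p q"
  by (auto simp: loop_homotopy_def path_homotopic_def loops_def unit_interval_topology_def)

lemma equiv_loop_homotopy: "equiv (loops X x) (loop_homotopy X x)"
proof (rule equivI)
  show "loop_homotopy X x \<subseteq> loops X x \<times> loops X x"
    by (auto simp: loop_homotopy_def)
  show "refl_on (loops X x) (loop_homotopy X x)"
    by (rule refl_onI) (simp add: loop_homotopy_iff in_loops_iff path_homotopic_refl)
  show "sym (loop_homotopy X x)"
    by (rule symI) (simp add: loop_homotopy_iff path_homotopic_sym)
  show "trans (loop_homotopy X x)"
    by (rule transI) (use path_homotopic_trans in \<open>fastforce simp: loop_homotopy_iff\<close>)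
qed

lemma loop_class_eq_iff:
  assumes "p \<in> loops X x" "q \<in> loops X x"
  shows "loop_class X x p = loop_class X x q \<longleftrightarrow> path_homotopic X p q"
  unfolding loop_class_def using eq_equiv_class_iff[OF equiv_loop_homotopy assms] assms
  by (simp add: loop_homotopy_iff)

lemma loop_class_eqI:
  "p \<in> loops X x \<Longrightarrow> q \<in> loops X x \<Longrightarrow> path_homotopic X p q \<Longrightarrow> loop_class X x p = loop_class X x q"
  by (simp add: loop_class_eq_iff)

lemma carrier_fundamental_group: "carrier (fundamental_group X x) = loop_class X x ` loops X x"
  by (auto simp: fundamental_group_def quotient_def loop_class_def)

lemma mem_loop_class: "q \<in> loop_class X x p \<longleftrightarrow> p \<in> loops X x \<and> q \<in> loops X x \<and> path_homotopic X p q"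
  by (simp add: loop_class_def loop_homotopy_iff)

lemma const_path_loop: "x \<in> topspace X \<Longrightarrow> const_path x \<in> loops X x"
  by (simp add: in_loops_iff) (simp add: const_path_def)

lemma path_prod_loop:
  assumes "pathin X p" "pathin X q" "p 0 = x" "p 1 = q 0" "q 1 = x"
  shows "path_prod p q \<in> loops X x"
  using pathin_path_prod[OF assms(1,2,4)] assms by (simp add: in_loops_iff) (simp add: path_prod_def)

lemma path_prod_loops: "p \<in> loops X x \<Longrightarrow> q \<in> loops X x \<Longrightarrow> path_prod p q \<in> loops X x"
  by (rule path_prod_loop) (auto simp: in_loops_iff)

lemma path_rev_loops: "p \<in> loops X x \<Longrightarrow> path_rev p \<in> loops X x"
  by (auto simp: in_loops_iff pathin_path_rev) (simp add: path_rev_def)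

lemma one_fundamental_group: "\<one>\<^bsub>fundamental_group X x\<^esub> = loop_class X x (const_path x)"
  by (simp add: fundamental_group_def)

text \<open>The product of classes is a union over all representatives. All sets in it coincide, and
  the index sets are nonempty because each loop lies in its own class, so the union is a single
  class.\<close>

lemma mult_loop_class:
  assumes "p \<in> loops X x" "q \<in> loops X x"
  shows "loop_class X x p \<otimes>\<^bsub>fundamental_group X x\<^esub> loop_class X x q = loop_class X x (path_prod p q)"
proof -
  let ?P = "loop_class X x p" and ?Q = "loop_class X x q"
  have eq: "loop_class X x (path_prod p' q') = loop_class X x (path_prod p q)"
    if "p' \<in> ?P" "q' \<in> ?Q" for p' q'
    using that by (intro loop_class_eqI path_prod_loops path_homotopic_prod assms)
      (auto simp: mem_loop_class in_loops_iff path_homotopic_sym)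
  have "p \<in> ?P" "q \<in> ?Q"
    using assms by (simp_all add: mem_loop_class in_loops_iff path_homotopic_refl)
  then have "?P \<noteq> {}" "?Q \<noteq> {}" by blast+
  have "?P \<otimes>\<^bsub>fundamental_group X x\<^esub> ?Q = (\<Union>p'\<in>?P. \<Union>q'\<in>?Q. loop_class X x (path_prod p' q'))"
    by (simp add: fundamental_group_def)
  also have "\<dots> = (\<Union>p'\<in>?P. \<Union>q'\<in>?Q. loop_class X x (path_prod p q))"
    by (intro SUP_cong refl eq)
  also have "\<dots> = loop_class X x (path_prod p q)"
    using \<open>?P \<noteq> {}\<close> \<open>?Q \<noteq> {}\<close> by simp
  finally show ?thesis .
qed

lemma group_fundamental_group:
  assumes "x \<in> topspace X"
  shows "group (fundamental_group X x)"
proof (rule groupI)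
  note [simp] = mult_loop_class path_prod_loops const_path_loop[OF assms] path_rev_loops
  let ?G = "fundamental_group X x"
  show "\<one>\<^bsub>?G\<^esub> \<in> carrier ?G"
    by (simp add: one_fundamental_group carrier_fundamental_group)
  fix a assume "a \<in> carrier ?G"
  then obtain p where p: "p \<in> loops X x" "a = loop_class X x p"
    by (auto simp: carrier_fundamental_group)
  show "\<one>\<^bsub>?G\<^esub> \<otimes>\<^bsub>?G\<^esub> a = a"
    using p by (simp add: one_fundamental_group loop_class_eq_iff)
      (simp add: in_loops_iff path_homotopic_const_left)
  have "loop_class X x (path_rev p) \<otimes>\<^bsub>?G\<^esub> a = \<one>\<^bsub>?G\<^esub>"
    using p path_homotopic_rev_left[of X p]
    by (simp add: one_fundamental_group loop_class_eq_iff) (simp add: in_loops_iff)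
  then show "\<exists>b \<in> carrier ?G. b \<otimes>\<^bsub>?G\<^esub> a = \<one>\<^bsub>?G\<^esub>"
    using p(1) by (auto simp: carrier_fundamental_group)
  fix b assume "b \<in> carrier ?G"
  then obtain q where q: "q \<in> loops X x" "b = loop_class X x q"
    by (auto simp: carrier_fundamental_group)
  show "a \<otimes>\<^bsub>?G\<^esub> b \<in> carrier ?G"
    using p q by (simp add: carrier_fundamental_group)
  fix c assume "c \<in> carrier ?G"
  then obtain r where r: "r \<in> loops X x" "c = loop_class X x r"
    by (auto simp: carrier_fundamental_group)
  show "a \<otimes>\<^bsub>?G\<^esub> b \<otimes>\<^bsub>?G\<^esub> c = a \<otimes>\<^bsub>?G\<^esub> (b \<otimes>\<^bsub>?G\<^esub> c)"
    using p q r by (simp add: loop_class_eq_iff)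
      (simp add: in_loops_iff path_homotopic_assoc)
qed

lemma inv_loop_class:
  assumes "x \<in> topspace X" "p \<in> loops X x"
  shows "inv\<^bsub>fundamental_group X x\<^esub> (loop_class X x p) = loop_class X x (path_rev p)"
proof (rule group.inv_equality[OF group_fundamental_group[OF assms(1)]])
  show "loop_class X x (path_rev p) \<otimes>\<^bsub>fundamental_group X x\<^esub> loop_class X x p = \<one>\<^bsub>fundamental_group X x\<^esub>"
    using assms path_homotopic_rev_left[of X p]
    by (simp add: one_fundamental_group mult_loop_class path_rev_loops path_prod_loops
        const_path_loop loop_class_eq_iff) (simp add: in_loops_iff)
qed (use assms in \<open>auto simp: carrier_fundamental_group path_rev_loops\<close>)

subsection \<open>Coset topologies\<close>

text \<open>The open sets are the unions of cosets: the topology pulled back from the discrete coset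
  space.\<close>

definition coset_topology :: "('g, 'm) monoid_scheme \<Rightarrow> 'g set \<Rightarrow> 'g topology" where
  "coset_topology G N = pullback_topology (carrier G) (\<lambda>a. N #>\<^bsub>G\<^esub> a) (discrete_topology UNIV)"

lemma openin_coset_topology:
  "openin (coset_topology G N) W \<longleftrightarrow> (\<exists>\<C>. W = {a \<in> carrier G. N #>\<^bsub>G\<^esub> a \<in> \<C>})"
  by (auto simp: coset_topology_def openin_pullback_topology)

lemma topspace_coset_topology [simp]: "topspace (coset_topology G N) = carrier G"
  by (simp add: coset_topology_def topspace_pullback_topology)

text \<open>For normal \<open>N\<close> the coset of a product or an inverse depends only on the
  cosets of the arguments, so both operations are continuous already on the discrete
  quotient.\<close>

lemma topological_group_coset_topology:
  fixes G (structure)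
  assumes "N \<lhd> G"
  shows "topological_group G (coset_topology G N)"
proof -
  interpret normal N G by fact
  let ?T = "coset_topology G N"
  \<comment> \<open>Continuity into \<open>?T\<close> is local constancy of the coset of the
    value.\<close>
  have pres: "continuous_map S ?T f"
    if f: "\<And>z. z \<in> topspace S \<Longrightarrow> f z \<in> carrier G"
      and nb: "\<And>z. z \<in> topspace S \<Longrightarrow> \<exists>V. openin S V \<and> z \<in> V \<and> (\<forall>w\<in>V. N #> f w = N #> f z)"
    for S :: "'c topology" and f
  proof -
    have "openin S {z \<in> topspace S. f z \<in> W}" if W: "openin ?T W" for W
    proof (subst openin_subopen, intro ballI)
      fix z assume z: "z \<in> {z \<in> topspace S. f z \<in> W}"
      then obtain V where V: "openin S V" "z \<in> V" "\<forall>w\<in>V. N #> f w = N #> f z"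
        using nb[of z] by blast
      have "V \<subseteq> topspace S" using V(1) by (rule openin_subset)
      moreover obtain \<C> where "W = {a \<in> carrier G. N #> a \<in> \<C>}"
        using W by (auto simp: openin_coset_topology)
      ultimately have "V \<subseteq> {z \<in> topspace S. f z \<in> W}"
        using V(3) z f by auto
      with V show "\<exists>T. openin S T \<and> z \<in> T \<and> T \<subseteq> {z \<in> topspace S. f z \<in> W}" by blast
    qed
    with f show ?thesis
      by (simp add: continuous_map_def)
  qed
  \<comment> \<open>The coset of \<open>a\<close> is open. These sets, and products of two of them,
    are the neighbourhoods on which the operations have constant coset.\<close>
  have op: "openin ?T {b \<in> carrier G. N #> b = N #> a}" for a
    unfolding openin_coset_topology by (rule exI[of _ "{N #> a}"]) auto
  have "continuous_map (prod_topology ?T ?T) ?T (\<lambda>(a, b). a \<otimes> b)"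
  proof (rule pres)
    fix z assume "z \<in> topspace (prod_topology ?T ?T)"
    then obtain a b where z: "z = (a, b)" "a \<in> carrier G" "b \<in> carrier G" by auto
    let ?V = "{c \<in> carrier G. N #> c = N #> a} \<times> {c \<in> carrier G. N #> c = N #> b}"
    have "openin (prod_topology ?T ?T) ?V"
      using op by (simp add: openin_prod_Times_iff)
    moreover
    have "N #> (c \<otimes> d) = N #> (a \<otimes> b)" if "(c, d) \<in> ?V" for c d
      using that z rcos_sum[of c d] rcos_sum[of a b] by simp
    then have "N #> (case w of (a, b) \<Rightarrow> a \<otimes> b) = N #> (case z of (a, b) \<Rightarrow> a \<otimes> b)"
      if "w \<in> ?V" for w
      using that unfolding z(1) by (cases w) (simp only: case_prod_conv)
    moreover have "z \<in> ?V" using z by simp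
    ultimately show "\<exists>V. openin (prod_topology ?T ?T) V \<and> z \<in> V \<and>
        (\<forall>w\<in>V. N #> (case w of (a, b) \<Rightarrow> a \<otimes> b) = N #> (case z of (a, b) \<Rightarrow> a \<otimes> b))"
      by blast
  qed auto
  moreover have "continuous_map ?T ?T (\<lambda>a. inv a)"
  proof (rule pres)
    fix a assume "a \<in> topspace ?T"
    then have a: "a \<in> carrier G" by simp
    let ?V = "{b \<in> carrier G. N #> b = N #> a}"
    have "N #> inv b = N #> inv a" if "b \<in> ?V" for b
      using that a rcos_inv[of b] rcos_inv[of a] by simp
    moreover have "a \<in> ?V" using a by simp
    ultimately show "\<exists>V. openin ?T V \<and> a \<in> V \<and> (\<forall>w\<in>V. N #> inv w = N #> inv a)"
      using op[of a] by blast
  qed auto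
  ultimately show ?thesis
    by (simp add: topological_group_def is_group)
qed

subsection \<open>The subgroup generated by lassos of a cover\<close>

definition lasso_in :: "'a topology \<Rightarrow> 'a set set \<Rightarrow> 'a \<Rightarrow> (real \<Rightarrow> 'a) \<Rightarrow> (real \<Rightarrow> 'a) \<Rightarrow> bool" where
  "lasso_in X \<U> x u v \<longleftrightarrow> pathin X u \<and> u 0 = x \<and> pathin X v \<and> v 0 = u 1 \<and> v 1 = u 1 \<and>
     (\<exists>U\<in>\<U>. v ` {0..1} \<subseteq> U)"

definition lasso :: "(real \<Rightarrow> 'a) \<Rightarrow> (real \<Rightarrow> 'a) \<Rightarrow> real \<Rightarrow> 'a" where
  "lasso u v = path_prod (path_prod u v) (path_rev u)"

text \<open>Taking a generated subgroup makes the subgroup laws automatic and reduces normality to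
  conjugating single lassos.\<close>

definition lasso_group :: "'a topology \<Rightarrow> 'a set set \<Rightarrow> 'a \<Rightarrow> (real \<Rightarrow> 'a) set set" where
  "lasso_group X \<U> x =
     generate (fundamental_group X x) {loop_class X x (lasso u v) | u v. lasso_in X \<U> x u v}"

lemma lasso_loop: "lasso_in X \<U> x u v \<Longrightarrow> lasso u v \<in> loops X x"
  unfolding lasso_in_def lasso_def
  by (intro path_prod_loop pathin_path_prod pathin_path_rev) auto

lemma loop_class_lasso_in_lasso_group:
  "lasso_in X \<U> x u v \<Longrightarrow> loop_class X x (lasso u v) \<in> lasso_group X \<U> x"
  unfolding lasso_group_def by (intro generate.incl) blast

text \<open>Conjugating by \<open>g\<close> only lengthens the tail from \<open>u\<close> to
  \<open>g u\<close> and leaves the small loop \<open>v\<close> alone. The generating set is thus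
  closed under conjugation, which gives normality.\<close>

lemma lasso_conjugate:
  assumes "lasso_in X \<U> x u v" "g \<in> loops X x"
  shows "lasso_in X \<U> x (path_prod g u) v"
    and "path_homotopic X (path_prod (path_prod g (lasso u v)) (path_rev g)) (lasso (path_prod g u) v)"
proof -
  note a = assms[unfolded lasso_in_def in_loops_iff]
  then show "lasso_in X \<U> x (path_prod g u) v"
    by (simp add: lasso_in_def pathin_path_prod)
  note [simp] = pathin_path_prod pathin_path_rev path_homotopic_refl
  have "path_homotopic X (path_prod g (lasso u v))
      (path_prod (path_prod g (path_prod u v)) (path_rev u))"
    unfolding lasso_def using a by (intro path_homotopic_sym[OF path_homotopic_assoc]) simp_all
  also have "path_homotopic X \<dots> (path_prod (path_prod (path_prod g u) v) (path_rev u))"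
    using a by (intro path_homotopic_prod path_homotopic_sym[OF path_homotopic_assoc]) simp_all
  finally have "path_homotopic X (path_prod (path_prod g (lasso u v)) (path_rev g))
      (path_prod (path_prod (path_prod (path_prod g u) v) (path_rev u)) (path_rev g))"
    by (rule path_homotopic_prod) (use a in \<open>simp_all add: lasso_def\<close>)
  also have "path_homotopic X \<dots>
      (path_prod (path_prod (path_prod g u) v) (path_prod (path_rev u) (path_rev g)))"
    using a by (intro path_homotopic_assoc) simp_all
  also have "\<dots> = lasso (path_prod g u) v"
    using a by (simp add: lasso_def path_rev_prod)
  finally show "path_homotopic X (path_prod (path_prod g (lasso u v)) (path_rev g)) (lasso (path_prod g u) v)" .
qed

text \<open>Reversing a lasso reverses \<open>v\<close>, whose image does not grow; this provides
  inverses among the Spanier products.\<close>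

lemma lasso_rev:
  assumes "lasso_in X \<U> x u v"
  shows "lasso_in X \<U> x u (path_rev v)"
    and "path_homotopic X (path_rev (lasso u v)) (lasso u (path_rev v))"
proof -
  note a = assms[unfolded lasso_in_def]
  have "path_rev v ` {0..1} \<subseteq> v ` {0..1}"
    by (auto simp: path_rev_def)
  then show "lasso_in X \<U> x u (path_rev v)"
    using a by (auto simp: lasso_in_def pathin_path_rev)
  note [simp] = pathin_path_prod pathin_path_rev path_homotopic_refl
  have "path_homotopic X (path_prod (path_rev (path_rev u)) (path_prod (path_rev v) (path_rev u)))
      (path_prod u (path_prod (path_rev v) (path_rev u)))"
    using a by (intro path_homotopic_prod path_homotopic_sym[OF path_homotopic_eqI] path_rev_rev) simp_all
  also have "path_homotopic X \<dots> (lasso u (path_rev v))"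
    unfolding lasso_def using a by (intro path_homotopic_sym[OF path_homotopic_assoc]) simp_all
  finally show "path_homotopic X (path_rev (lasso u v)) (lasso u (path_rev v))"
    using a by (simp add: lasso_def path_rev_prod)
qed

lemma lasso_classes_subset_carrier:
  "{loop_class X x (lasso u v) | u v. lasso_in X \<U> x u v} \<subseteq> carrier (fundamental_group X x)"
  by (auto simp: carrier_fundamental_group intro!: imageI lasso_loop)

lemma normal_lasso_group:
  assumes "x \<in> topspace X"
  shows "lasso_group X \<U> x \<lhd> fundamental_group X x"
proof -
  let ?G = "fundamental_group X x"
  interpret group ?G by (rule group_fundamental_group[OF assms])
  show ?thesis
    unfolding lasso_group_def
  proof (rule normal_generateI[OF lasso_classes_subset_carrier])
    fix h a assume "h \<in> {loop_class X x (lasso u v) | u v. lasso_in X \<U> x u v}" "a \<in> carrier ?G"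
    then obtain u v g where *: "lasso_in X \<U> x u v" "h = loop_class X x (lasso u v)"
      "g \<in> loops X x" "a = loop_class X x g"
      by (auto simp: carrier_fundamental_group)
    have "a \<otimes>\<^bsub>?G\<^esub> h \<otimes>\<^bsub>?G\<^esub> inv\<^bsub>?G\<^esub> a =
        loop_class X x (path_prod (path_prod g (lasso u v)) (path_rev g))"
      using * assms lasso_loop[OF *(1)]
      by (simp add: inv_loop_class mult_loop_class path_prod_loops path_rev_loops)
    also have "\<dots> = loop_class X x (lasso (path_prod g u) v)"
      by (intro loop_class_eqI path_prod_loops path_rev_loops lasso_conjugate[OF *(1,3)] *(3)
          lasso_loop[OF *(1)] lasso_loop[OF lasso_conjugate(1)[OF *(1,3)]])
    finally show "a \<otimes>\<^bsub>?G\<^esub> h \<otimes>\<^bsub>?G\<^esub> inv\<^bsub>?G\<^esub> a \<in> {loop_class X x (lasso u v) | u v. lasso_in X \<U> x u v}"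
      using lasso_conjugate(1)[OF *(1,3)] by blast
  qed
qed

section \<open>Products of lassos and the Spanier group of a cover\<close>

lemma mem_spanier_group_of_cover:
  "A \<in> spanier_group_of_cover X \<U> x \<longleftrightarrow> A \<in> carrier (fundamental_group X x) \<and>
     (\<exists>ws. (\<forall>(u, v)\<in>set ws. lasso_in X \<U> x u v) \<and> spanier_loop x ws \<in> A)"
  by (simp add: spanier_group_of_cover_def lasso_in_def)

lemma spanier_loop_Nil: "spanier_loop x [] = const_path x"
  by (simp add: spanier_loop_def)

lemma spanier_loop_Cons: "spanier_loop x ((u, v) # ws) = path_prod (lasso u v) (spanier_loop x ws)"
  by (simp add: spanier_loop_def lasso_def)

lemma spanier_loop_loops:
  assumes "x \<in> topspace X" "\<forall>(u, v)\<in>set ws. lasso_in X \<U> x u v"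
  shows "spanier_loop x ws \<in> loops X x"
  using assms(2)
proof (induction ws)
  case (Cons w ws)
  then show ?case
    by (cases w) (auto simp: spanier_loop_Cons intro!: path_prod_loops lasso_loop)
qed (simp add: spanier_loop_Nil const_path_loop assms(1))

text \<open>Appending lists multiplies classes, so the classes of Spanier products are closed under
  multiplication.\<close>

lemma loop_class_spanier_loop_append:
  assumes "x \<in> topspace X" "\<forall>(u, v)\<in>set ws. lasso_in X \<U> x u v"
    "\<forall>(u, v)\<in>set ws'. lasso_in X \<U> x u v"
  shows "loop_class X x (spanier_loop x (ws @ ws')) =
    loop_class X x (spanier_loop x ws) \<otimes>\<^bsub>fundamental_group X x\<^esub> loop_class X x (spanier_loop x ws')"
  using assms(2)
proof (induction ws)
  case Nil
  have "loop_class X x (spanier_loop x ws') \<in> carrier (fundamental_group X x)"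
    using spanier_loop_loops[OF assms(1,3)] by (simp add: carrier_fundamental_group)
  then show ?case
    by (simp add: spanier_loop_Nil one_fundamental_group[symmetric]
        monoid.l_one[OF group.is_monoid[OF group_fundamental_group[OF assms(1)]]])
next
  case (Cons w ws)
  obtain u v where w: "w = (u, v)" by (cases w)
  let ?G = "fundamental_group X x"
  have l: "lasso u v \<in> loops X x" "spanier_loop x ws \<in> loops X x" "spanier_loop x ws' \<in> loops X x"
    "spanier_loop x (ws @ ws') \<in> loops X x"
    using Cons.prems assms w by (auto intro!: spanier_loop_loops lasso_loop)
  have "loop_class X x (spanier_loop x ((w # ws) @ ws')) =
      loop_class X x (lasso u v) \<otimes>\<^bsub>?G\<^esub>
        (loop_class X x (spanier_loop x ws) \<otimes>\<^bsub>?G\<^esub> loop_class X x (spanier_loop x ws'))"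
    using Cons l by (simp add: w spanier_loop_Cons mult_loop_class[symmetric])
  also have "\<dots> = loop_class X x (lasso u v) \<otimes>\<^bsub>?G\<^esub>
      loop_class X x (spanier_loop x ws) \<otimes>\<^bsub>?G\<^esub> loop_class X x (spanier_loop x ws')"
    using l by (intro monoid.m_assoc[OF group.is_monoid[OF group_fundamental_group[OF assms(1)]], symmetric])
      (simp_all add: carrier_fundamental_group)
  also have "\<dots> = loop_class X x (spanier_loop x (w # ws)) \<otimes>\<^bsub>?G\<^esub> loop_class X x (spanier_loop x ws')"
    using l by (simp add: w spanier_loop_Cons mult_loop_class)
  finally show ?case .
qed

text \<open>A class is determined by any loop in it. Membership of a representative thus becomes an
  equation in the group, to which products and inverses apply.\<close>

lemma mem_spanier_group_of_cover_iff_loop_class: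
  assumes "x \<in> topspace X"
  shows "A \<in> spanier_group_of_cover X \<U> x \<longleftrightarrow>
     (\<exists>ws. (\<forall>(u, v)\<in>set ws. lasso_in X \<U> x u v) \<and> A = loop_class X x (spanier_loop x ws))"
proof
  assume "A \<in> spanier_group_of_cover X \<U> x"
  then obtain p ws where p: "p \<in> loops X x" "A = loop_class X x p"
    and ws: "\<forall>(u, v)\<in>set ws. lasso_in X \<U> x u v" "spanier_loop x ws \<in> A"
    by (auto simp: mem_spanier_group_of_cover carrier_fundamental_group)
  then have "A = loop_class X x (spanier_loop x ws)"
    by (simp add: mem_loop_class loop_class_eq_iff)
  with ws(1) show "\<exists>ws. (\<forall>(u, v)\<in>set ws. lasso_in X \<U> x u v) \<and> A = loop_class X x (spanier_loop x ws)"
    by blast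
next
  assume "\<exists>ws. (\<forall>(u, v)\<in>set ws. lasso_in X \<U> x u v) \<and> A = loop_class X x (spanier_loop x ws)"
  then obtain ws where ws: "\<forall>(u, v)\<in>set ws. lasso_in X \<U> x u v" "A = loop_class X x (spanier_loop x ws)"
    by blast
  moreover have l: "spanier_loop x ws \<in> loops X x"
    using spanier_loop_loops[OF assms ws(1)] .
  moreover have "spanier_loop x ws \<in> loop_class X x (spanier_loop x ws)"
    using l by (simp add: mem_loop_class path_homotopic_refl in_loops_iff)
  ultimately show "A \<in> spanier_group_of_cover X \<U> x"
    by (auto simp: mem_spanier_group_of_cover carrier_fundamental_group)
qed

lemma lasso_class_in_spanier_group_of_cover:
  assumes "x \<in> topspace X" "lasso_in X \<U> x u v"
  shows "loop_class X x (lasso u v) \<in> spanier_group_of_cover X \<U> x"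
proof -
  have l: "lasso u v \<in> loops X x" using assms(2) by (rule lasso_loop)
  \<comment> \<open>A one-entry list yields the lasso followed by the constant loop that ends every
    \<open>spanier_loop\<close>.\<close>
  then have "loop_class X x (lasso u v) = loop_class X x (spanier_loop x [(u, v)])"
    unfolding spanier_loop_Cons spanier_loop_Nil
    by (intro loop_class_eqI path_prod_loops const_path_loop assms
        path_homotopic_sym[OF path_homotopic_const_right]) (simp_all add: in_loops_iff)
  then show ?thesis
    unfolding mem_spanier_group_of_cover_iff_loop_class[OF assms(1)]
    using assms(2) by (intro exI[of _ "[(u, v)]"]) simp
qed

text \<open>Induction over the generated subgroup: the identity is the empty list, an inverted
  generator is the lasso with \<open>v\<close> reversed, and a product is an appended list.\<close>

lemma lasso_group_subset_spanier_group_of_cover: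
  assumes "x \<in> topspace X"
  shows "lasso_group X \<U> x \<subseteq> spanier_group_of_cover X \<U> x"
proof
  fix A assume "A \<in> lasso_group X \<U> x"
  then show "A \<in> spanier_group_of_cover X \<U> x"
    unfolding lasso_group_def
  proof (induction rule: generate.induct)
    case one
    show ?case
      unfolding mem_spanier_group_of_cover_iff_loop_class[OF assms]
      by (rule exI[of _ "[]"]) (simp add: spanier_loop_Nil one_fundamental_group)
  next
    case (incl h)
    then show ?case using lasso_class_in_spanier_group_of_cover[OF assms] by blast
  next
    case (inv h)
    then obtain u v where uv: "lasso_in X \<U> x u v" "h = loop_class X x (lasso u v)" by blast
    then have "inv\<^bsub>fundamental_group X x\<^esub> h = loop_class X x (path_rev (lasso u v))"
      by (simp add: inv_loop_class[OF assms] lasso_loop)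
    also have "\<dots> = loop_class X x (lasso u (path_rev v))"
      by (intro loop_class_eqI path_rev_loops lasso_loop[OF uv(1)]
          lasso_loop[OF lasso_rev(1)[OF uv(1)]] lasso_rev(2)[OF uv(1)])
    finally show ?case
      using lasso_class_in_spanier_group_of_cover[OF assms lasso_rev(1)[OF uv(1)]] by simp
  next
    case (eng h1 h2)
    then obtain ws ws' where
      ws: "\<forall>(u, v)\<in>set ws. lasso_in X \<U> x u v" "h1 = loop_class X x (spanier_loop x ws)" and
      ws': "\<forall>(u, v)\<in>set ws'. lasso_in X \<U> x u v" "h2 = loop_class X x (spanier_loop x ws')"
      unfolding mem_spanier_group_of_cover_iff_loop_class[OF assms] by blast
    show ?case
      unfolding mem_spanier_group_of_cover_iff_loop_class[OF assms] ws(2) ws'(2)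
        loop_class_spanier_loop_append[OF assms ws(1) ws'(1), symmetric]
      using ws(1) ws'(1) by (intro exI[of _ "ws @ ws'"]) auto
  qed
qed

text \<open>Equality modulo the lasso group for paths from \<open>x\<close> with a common endpoint.
  Allowing paths, not just loops, makes partial runs along a ladder comparable.\<close>

definition lasso_rel :: "'a topology \<Rightarrow> 'a set set \<Rightarrow> 'a \<Rightarrow> (real \<Rightarrow> 'a) \<Rightarrow> (real \<Rightarrow> 'a) \<Rightarrow> bool" where
  "lasso_rel X \<U> x p q \<longleftrightarrow> pathin X p \<and> pathin X q \<and> p 0 = x \<and> q 0 = x \<and> p 1 = q 1 \<and>
     loop_class X x (path_prod p (path_rev q)) \<in> lasso_group X \<U> x"

lemma path_prod_rev_loop:
  assumes "pathin X p" "pathin X q" "p 0 = x" "q 0 = x" "p 1 = q 1"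
  shows "path_prod p (path_rev q) \<in> loops X x"
  using assms by (intro path_prod_loop pathin_path_rev) auto

lemma lasso_rel_homotopic:
  assumes "lasso_rel X \<U> x p q" "path_homotopic X p p'" "path_homotopic X q q'"
  shows "lasso_rel X \<U> x p' q'"
proof -
  note e = path_homotopic_ends[OF assms(2)] path_homotopic_ends[OF assms(3)]
  note a = assms(1)[unfolded lasso_rel_def]
  have "loop_class X x (path_prod p (path_rev q)) = loop_class X x (path_prod p' (path_rev q'))"
    by (intro loop_class_eqI path_prod_rev_loop path_homotopic_prod path_homotopic_rev assms)
      (use e a in auto)
  then show ?thesis using e a by (simp add: lasso_rel_def)
qed

text \<open>The difference loops multiply and the middle \<open>q^-1 q\<close> cancels.\<close>

lemma lasso_rel_trans [trans]:
  assumes pq: "lasso_rel X \<U> x p q" and qr: "lasso_rel X \<U> x q r"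
  shows "lasso_rel X \<U> x p r"
proof -
  note a = assms[unfolded lasso_rel_def]
  have "loop_class X x (path_prod p (path_rev q)) \<otimes>\<^bsub>fundamental_group X x\<^esub>
      loop_class X x (path_prod q (path_rev r)) =
      loop_class X x (path_prod (path_prod p (path_rev q)) (path_prod q (path_rev r)))"
    using a by (intro mult_loop_class path_prod_rev_loop) auto
  also have "\<dots> = loop_class X x (path_prod p (path_rev r))"
    using a by (intro loop_class_eqI path_prod_loops path_prod_rev_loop
        path_homotopic_prod_rev_cancel pathin_path_rev) auto
  finally show ?thesis
    using a generate.eng by (fastforce simp: lasso_rel_def lasso_group_def)
qed

text \<open>The tail \<open>r\<close> cancels against its reverse, so the difference loop keeps its
  class.\<close>

lemma lasso_rel_prod:
  assumes pq: "lasso_rel X \<U> x p q" and r: "pathin X r" "r 0 = p 1"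
  shows "lasso_rel X \<U> x (path_prod p r) (path_prod q r)"
proof -
  note a = assms[unfolded lasso_rel_def]
  have "loop_class X x (path_prod (path_prod p r) (path_rev (path_prod q r))) =
      loop_class X x (path_prod p (path_rev q))"
    using a by (intro loop_class_eqI path_prod_rev_loop)
      (simp_all add: path_rev_prod pathin_path_rev pathin_path_prod path_homotopic_prod_cancel_rev)
  then show ?thesis
    using a by (simp add: lasso_rel_def pathin_path_prod)
qed

text \<open>The difference loop of \<open>u v\<close> and \<open>u\<close> is literally
  \<open>lasso u v\<close>.\<close>

lemma lasso_rel_prod_loop:
  assumes "lasso_in X \<U> x u v"
  shows "lasso_rel X \<U> x (path_prod u v) u"
  using loop_class_lasso_in_lasso_group[OF assms] assms
  by (simp add: lasso_rel_def lasso_def lasso_in_def pathin_path_prod)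

lemma image_path_prod:
  "p ` {0..1} \<subseteq> U \<Longrightarrow> q ` {0..1} \<subseteq> U \<Longrightarrow> path_prod p q ` {0..1} \<subseteq> U"
  by (auto simp: path_prod_def image_subset_iff)

lemma image_path_rev: "p ` {0..1} \<subseteq> U \<Longrightarrow> path_rev p ` {0..1} \<subseteq> U"
  by (auto simp: path_rev_def image_subset_iff)

text \<open>One cell of the ladder: \<open>v w^-1\<close> is a loop inside \<open>U\<close>, so
  \<open>u (v w^-1)\<close> is related to \<open>u\<close>. Appending \<open>w\<close> turns the
  former into \<open>u v\<close> up to homotopy and the latter into \<open>u w\<close>.\<close>

lemma lasso_rel_prod_in_member:
  assumes u: "pathin X u" "u 0 = x"
    and v: "pathin X v" "v 0 = u 1" "v ` {0..1} \<subseteq> U"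
    and w: "pathin X w" "w 0 = u 1" "w ` {0..1} \<subseteq> U" "v 1 = w 1"
    and U: "U \<in> \<U>"
  shows "lasso_rel X \<U> x (path_prod u v) (path_prod u w)"
proof -
  note [simp] = u v w path_homotopic_refl pathin_path_prod pathin_path_rev
  let ?l = "path_prod v (path_rev w)"
  have l: "lasso_in X \<U> x u ?l"
    unfolding lasso_in_def using U image_path_prod[OF v(3) image_path_rev[OF w(3)]]
    by (intro conjI bexI[of _ U]) simp_all
  have "lasso_rel X \<U> x (path_prod (path_prod u ?l) w) (path_prod u w)"
    by (rule lasso_rel_prod[OF lasso_rel_prod_loop[OF l]]) simp_all
  moreover have "path_homotopic X (path_prod (path_prod u ?l) w) (path_prod u v)"
  proof -
    have "path_homotopic X (path_prod (path_prod u ?l) w)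
        (path_prod (path_prod (path_prod u v) (path_rev w)) w)"
      by (intro path_homotopic_prod path_homotopic_sym[OF path_homotopic_assoc]) simp_all
    also have "path_homotopic X \<dots> (path_prod (path_prod u v) (path_prod (path_rev w) w))"
      by (intro path_homotopic_assoc) simp_all
    also have "path_homotopic X \<dots> (path_prod (path_prod u v) (const_path (w 1)))"
      by (intro path_homotopic_prod path_homotopic_rev_left) simp_all
    also have "path_homotopic X \<dots> (path_prod u v)"
      by (intro path_homotopic_const_right) simp_all
    finally show ?thesis .
  qed
  ultimately show ?thesis
    by (rule lasso_rel_homotopic) simp
qed

lemma coset_eq_of_lasso_rel:
  assumes x: "x \<in> topspace X" and pq: "p \<in> loops X x" "q \<in> loops X x" and rel: "lasso_rel X \<U> x p q"
  defines "G \<equiv> fundamental_group X x" and "N \<equiv> lasso_group X \<U> x"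
  shows "N #>\<^bsub>G\<^esub> loop_class X x q = N #>\<^bsub>G\<^esub> loop_class X x p"
proof -
  interpret normal N G unfolding G_def N_def using x by (rule normal_lasso_group)
  let ?a = "loop_class X x p" and ?b = "loop_class X x q"
  have ab: "?a \<in> carrier G" "?b \<in> carrier G"
    using pq by (simp_all add: G_def carrier_fundamental_group)
  have "?a \<otimes>\<^bsub>G\<^esub> inv\<^bsub>G\<^esub> ?b = loop_class X x (path_prod p (path_rev q))"
    using x pq by (simp add: G_def inv_loop_class mult_loop_class path_rev_loops)
  then have "?a \<otimes>\<^bsub>G\<^esub> inv\<^bsub>G\<^esub> ?b \<in> N"
    using rel by (simp add: lasso_rel_def N_def)
  then have "?a \<otimes>\<^bsub>G\<^esub> inv\<^bsub>G\<^esub> ?b \<otimes>\<^bsub>G\<^esub> ?b \<in> N #>\<^bsub>G\<^esub> ?b"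
    using ab subset by (intro rcosI) auto
  then have "?a \<in> N #>\<^bsub>G\<^esub> ?b"
    using ab by (simp add: m_assoc)
  then show ?thesis
    using ab is_subgroup by (intro repr_independence) auto
qed

subsection \<open>Nearby loops\<close>

lemma openin_loop_space_maps_into:
  assumes "compactin unit_interval_topology K" "openin X U"
  shows "openin (loop_space X x) {f \<in> loops X x. f ` K \<subseteq> U}"
proof -
  let ?B = "{f \<in> extensional (topspace unit_interval_topology).
      continuous_map unit_interval_topology X f \<and> f ` K \<subseteq> U}"
  have "openin (compact_open_topology unit_interval_topology X) ?B"
    unfolding compact_open_topology_def
    by (rule topology_generated_by_Basis) (use assms in blast)
  then have "openin (loop_space X x) (loops X x \<inter> ?B)"
    unfolding loop_space_def by (rule openin_subtopology_Int2)
  also have "loops X x \<inter> ?B = {f \<in> loops X x. f ` K \<subseteq> U}"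
    by (auto simp: loops_def pathin_def unit_interval_topology_def)
  finally show ?thesis .
qed

text \<open>A Lebesgue number gives the mesh. The index \<open>i = n\<close> is included on purpose:
  its piece is cut down to the point 1, so the last subdivision point gets a member of the cover as
  well.\<close>

lemma path_subdivision:
  assumes p: "pathin X p" and \<U>: "open_cover X \<U>"
  obtains n :: nat where "n > 0"
    "\<And>i. i \<le> n \<Longrightarrow> \<exists>U\<in>\<U>. p ` ({real i / n..real (Suc i) / n} \<inter> {0..1}) \<subseteq> U"
proof -
  \<comment> \<open>Relatively open preimages are extended to open sets of reals, the form in which
    the Lebesgue number lemma takes a cover.\<close>
  define \<C> where "\<C> = {T. open T \<and> (\<exists>U\<in>\<U>. p ` (T \<inter> {0..1}) \<subseteq> U)}"
  have "{0..1} \<subseteq> \<Union>\<C>"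
  proof
    fix t :: real assume t: "t \<in> {0..1}"
    then have "p t \<in> topspace X"
      using p by (auto simp: pathin_def continuous_map_def)
    then obtain U where U: "U \<in> \<U>" "p t \<in> U" "openin X U"
      using \<U> by (auto simp: open_cover_def)
    have "openin (top_of_set {0..1}) {s \<in> {0..1}. p s \<in> U}"
      using openin_continuous_map_preimage[OF p[unfolded pathin_def] U(3)] by simp
    then obtain T where T: "open T" "{s \<in> {0..1}. p s \<in> U} = {0..1} \<inter> T"
      unfolding openin_open by blast
    then have "T \<in> \<C>" "t \<in> T"
      using U t by (auto simp: \<C>_def)
    then show "t \<in> \<Union>\<C>" by blast
  qed
  moreover from this have "\<C> \<noteq> {}" by auto
  moreover have "open B" if "B \<in> \<C>" for B using that by (simp add: \<C>_def)
  ultimately obtain \<delta> where \<delta>: "0 < \<delta>" "\<And>T. \<lbrakk>T \<subseteq> {0..1::real}; diameter T < \<delta>\<rbrakk> \<Longrightarrow> \<exists>B\<in>\<C>. T \<subseteq> B"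
    using Lebesgue_number_lemma[OF compact_Icc] by metis
  obtain m where m: "inverse (real (Suc m)) < \<delta>"
    using reals_Archimedean[OF \<delta>(1)] by blast
  define n where "n = Suc m"
  have "\<exists>U\<in>\<U>. p ` ({real i / n..real (Suc i) / n} \<inter> {0..1}) \<subseteq> U" for i
  proof -
    let ?T = "{real i / n..real (Suc i) / n} \<inter> {0..1}"
    have "diameter ?T \<le> diameter {real i / n..real (Suc i) / n}"
      by (intro diameter_subset) auto
    also have "\<dots> = inverse (real n)"
      by (simp add: n_def diameter_closed_interval field_simps)
    finally have "diameter ?T < \<delta>" using m by (simp add: n_def)
    then obtain B where "B \<in> \<C>" "?T \<subseteq> B" using \<delta>(2)[of ?T] by auto
    then obtain U where U: "U \<in> \<U>" "p ` (B \<inter> {0..1}) \<subseteq> U" by (auto simp: \<C>_def)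
    have "p ` ?T \<subseteq> p ` (B \<inter> {0..1})" using \<open>?T \<subseteq> B\<close> by (intro image_mono) blast
    with U(2) have "p ` ?T \<subseteq> U" by (rule order_trans[rotated])
    with U(1) show ?thesis by (rule bexI[rotated])
  qed
  then show thesis by (intro that[of n]) (auto simp: n_def)
qed

lemma subpath_in_image:
  assumes "a \<le> b"
  shows "subpath_in p a b ` {0..1} = p ` {a..b}"
  using assms unfolding subpath_in_def image_comp[symmetric] linepath_image_01
  by (simp add: closed_segment_eq_real_ivl)

text \<open>A ladder with rails \<open>p\<close> and \<open>q\<close>, rungs in the sets
  \<open>V i\<close> and the i-th cell in \<open>U i\<close>. \<open>V i\<close> lies in
  \<open>U i\<close> and, for positive i, in \<open>U (i - 1)\<close>, so both rungs of a cell stay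
  in its member of the cover.\<close>

lemma lasso_rel_of_close_paths:
  fixes n :: nat
  defines "t \<equiv> (\<lambda>i. real i / real n)"
  assumes n: "n > 0" and p: "pathin X p" "p 0 = x" and q: "pathin X q" "q 0 = x"
    and pq: "p 1 = q 1"
    and U: "\<And>i. i \<le> n \<Longrightarrow> U i \<in> \<U>"
    and pU: "\<And>i. i < n \<Longrightarrow> p ` {t i..t (Suc i)} \<subseteq> U i"
    and qU: "\<And>i. i < n \<Longrightarrow> q ` {t i..t (Suc i)} \<subseteq> U i"
    and V: "\<And>i. i \<le> n \<Longrightarrow> path_connectedin X (V i)"
    and pV: "\<And>i. i \<le> n \<Longrightarrow> p (t i) \<in> V i"
    and qV: "\<And>i. i \<le> n \<Longrightarrow> q (t i) \<in> V i"
    and VU: "\<And>i. i \<le> n \<Longrightarrow> V i \<subseteq> U i" "\<And>i. i < n \<Longrightarrow> V (Suc i) \<subseteq> U i"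
  shows "lasso_rel X \<U> x p q"
proof -
  have t01: "0 \<le> t i" "i \<le> n \<Longrightarrow> t i \<le> 1" for i
    using n by (auto simp: t_def)
  have tmono: "t i \<le> t (Suc i)" for i
    by (simp add: t_def divide_right_mono)
  have t0: "t 0 = 0" and tn: "t n = 1" using n by (simp_all add: t_def)
  note [simp] = p q pathin_subpath_in pathin_path_prod path_homotopic_refl t01
  \<comment> \<open>The rung \<open>g\<close> is arbitrary in the induction: the step picks its own
    rung \<open>h\<close> at \<open>t i\<close> and applies the hypothesis to that one.\<close>
  have main: "lasso_rel X \<U> x (path_prod (subpath_in p 0 (t i)) g) (subpath_in q 0 (t i))"
    if "i \<le> n" "pathin X g" "g ` {0..1} \<subseteq> V i" "g 0 = p (t i)" "g 1 = q (t i)" for i g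
    using that
  proof (induction i arbitrary: g)
    case 0
    \<comment> \<open>At \<open>t 0 = 0\<close> both rails are at \<open>x\<close>, so the rung is
      itself a small loop in \<open>U 0\<close>.\<close>
    have rel: "lasso_rel X \<U> x (path_prod (subpath_in p 0 (t 0)) g) (subpath_in p 0 (t 0))"
      by (rule lasso_rel_prod_loop) (use 0 U[of 0] VU(1)[of 0] t0 in \<open>auto simp: lasso_in_def\<close>)
    have hom: "path_homotopic X (subpath_in p 0 (t 0)) (subpath_in q 0 (t 0))"
    proof (rule path_homotopic_eqI)
      show "pathin X (subpath_in p 0 (t 0))"
        by (intro pathin_subpath_in p) (simp_all add: t0)
    qed (simp add: subpath_in_def linepath_def t0)
    have "pathin X (path_prod (subpath_in p 0 (t 0)) g)"
      using 0 by (intro pathin_path_prod pathin_subpath_in p) (simp_all add: t0)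
    then show ?case
      by (rule lasso_rel_homotopic[OF rel path_homotopic_refl hom])
  next
    case (Suc i)
    then have i: "i \<le> n" "i < n" "Suc i \<le> n" by simp_all
    obtain h where h: "pathin X h" "h ` {0..1} \<subseteq> V i" "h 0 = p (t i)" "h 1 = q (t i)"
      using V[OF i(1)] pV[OF i(1)] qV[OF i(1)] unfolding path_connectedin
      by (fastforce simp: image_subset_iff Pi_iff)
    let ?p = "subpath_in p 0 (t i)" and ?q = "subpath_in q 0 (t i)"
    let ?ps = "subpath_in p (t i) (t (Suc i))" and ?qs = "subpath_in q (t i) (t (Suc i))"
    note [simp] = i h Suc.prems
    have im: "?ps ` {0..1} \<subseteq> U i" "?qs ` {0..1} \<subseteq> U i" "h ` {0..1} \<subseteq> U i" "g ` {0..1} \<subseteq> U i"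
      using pU[OF i(2)] qU[OF i(2)] order_trans[OF h(2) VU(1)[OF i(1)]]
        order_trans[OF Suc.prems(3) VU(2)[OF i(2)]]
      by (simp_all only: subpath_in_image tmono)
    \<comment> \<open>The two routes around the i-th cell, from \<open>p (t i)\<close> to
      \<open>q (t (Suc i))\<close>: along \<open>p\<close> then rung \<open>g\<close>, or rung
      \<open>h\<close> then along \<open>q\<close>.\<close>
    have "lasso_rel X \<U> x (path_prod ?p (path_prod ?ps g)) (path_prod ?p (path_prod h ?qs))"
      by (rule lasso_rel_prod_in_member[OF _ _ _ _ image_path_prod[OF im(1,4)] _ _
            image_path_prod[OF im(3,2)] _ U[OF i(1)]])
        simp_all
    then have 1: "lasso_rel X \<U> x (path_prod (subpath_in p 0 (t (Suc i))) g)
        (path_prod (path_prod ?p h) ?qs)"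
    proof (rule lasso_rel_homotopic)
      have "path_homotopic X (path_prod ?p (path_prod ?ps g)) (path_prod (path_prod ?p ?ps) g)"
        by (rule path_homotopic_sym[OF path_homotopic_assoc]) simp_all
      also have "path_homotopic X \<dots> (path_prod (subpath_in p 0 (t (Suc i))) g)"
        by (intro path_homotopic_prod path_homotopic_subpath_in_join) simp_all
      finally show "path_homotopic X (path_prod ?p (path_prod ?ps g))
          (path_prod (subpath_in p 0 (t (Suc i))) g)" .
      show "path_homotopic X (path_prod ?p (path_prod h ?qs)) (path_prod (path_prod ?p h) ?qs)"
        by (rule path_homotopic_sym[OF path_homotopic_assoc]) simp_all
    qed
    have "lasso_rel X \<U> x (path_prod ?p h) ?q"
      by (rule Suc.IH) simp_all
    then have "lasso_rel X \<U> x (path_prod (path_prod ?p h) ?qs) (path_prod ?q ?qs)"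
      by (rule lasso_rel_prod) simp_all
    then have 2: "lasso_rel X \<U> x (path_prod (path_prod ?p h) ?qs) (subpath_in q 0 (t (Suc i)))"
      by (rule lasso_rel_homotopic) (simp_all add: path_homotopic_subpath_in_join)
    show ?case using 1 2 by (rule lasso_rel_trans)
  qed
  \<comment> \<open>Since \<open>p 1 = q 1\<close>, the last rung can be constant and drops out up
    to homotopy.\<close>
  have "p 1 \<in> topspace X" using p(1) by (rule path_finish_in_topspace)
  then have "lasso_rel X \<U> x (path_prod (subpath_in p 0 (t n)) (const_path (p 1))) (subpath_in q 0 (t n))"
  proof (intro main)
    show "const_path (p 1) ` {0..1} \<subseteq> V n"
      using pV[of n] tn by (auto simp: const_path_def)
  qed (use tn pq in simp_all)
  then show ?thesis
  proof (rule lasso_rel_homotopic)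
    have "path_homotopic X (path_prod (subpath_in p 0 (t n)) (const_path (p 1))) (subpath_in p 0 (t n))"
      by (rule path_homotopic_const_right) (simp_all add: tn)
    also have "path_homotopic X \<dots> p"
      by (simp add: tn path_homotopic_subpath_in_trivial)
    finally show "path_homotopic X (path_prod (subpath_in p 0 (t n)) (const_path (p 1))) p" .
  qed (simp add: tn path_homotopic_subpath_in_trivial)
qed

text \<open>Finitely many subbasic conditions suffice: \<open>q\<close> maps the i-th piece into
  \<open>U i\<close>, and maps \<open>t i\<close> into a path connected \<open>V i\<close> around
  \<open>p (t i)\<close>, where the rung is found.\<close>

lemma lasso_rel_neighbourhood:
  assumes lpc: "locally_path_connected_space X" and \<U>: "open_cover X \<U>" and p: "p \<in> loops X x"
  obtains W where "openin (loop_space X x) W" "p \<in> W" "\<And>q. q \<in> W \<Longrightarrow> lasso_rel X \<U> x p q"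
proof -
  have pp: "pathin X p" "p 0 = x" "p 1 = x" using p by (simp_all add: in_loops_iff)
  obtain n :: nat where n: "n > 0"
    and sub: "\<And>i. i \<le> n \<Longrightarrow> \<exists>U\<in>\<U>. p ` ({real i / n..real (Suc i) / n} \<inter> {0..1}) \<subseteq> U"
    using path_subdivision[OF pp(1) \<U>] by blast
  define t where "t i = real i / real n" for i
  \<comment> \<open>Intersecting with \<open>{0..1}\<close> keeps the pieces compact in the interval
    and makes \<open>K n\<close> the point 1.\<close>
  define K where "K i = {t i..t (Suc i)} \<inter> {0..1}" for i
  have "\<exists>U. \<forall>i\<le>n. U i \<in> \<U> \<and> p ` K i \<subseteq> U i"
    using sub unfolding K_def t_def by metis
  then obtain U where U: "\<And>i. i \<le> n \<Longrightarrow> U i \<in> \<U>" and pU: "\<And>i. i \<le> n \<Longrightarrow> p ` K i \<subseteq> U i"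
    by blast
  have oU: "openin X (U i)" if "i \<le> n" for i
    using U[OF that] \<U> by (simp add: open_cover_def)
  have t01: "t i \<in> {0..1}" if "i \<le> n" for i
    using that n by (auto simp: t_def)
  have tK: "t i \<in> K i" "t i \<in> K (i - 1)" if "i \<le> n" for i
    using t01[OF that] by (cases i; auto simp: K_def t_def divide_right_mono)+
  (* for i = 0 truncated subtraction makes U (i - 1) just U 0 *)
  have "\<exists>V. openin X V \<and> path_connectedin X V \<and> p (t i) \<in> V \<and> V \<subseteq> U i \<inter> U (i - 1)" if "i \<le> n" for i
  proof -
    have "openin X (U i \<inter> U (i - 1))" using that oU by auto
    moreover have "p (t i) \<in> U i \<inter> U (i - 1)"
    proof
      show "p (t i) \<in> U i" using tK(1)[OF that] pU[OF that] by blast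
      have "i - 1 \<le> n" using that by simp
      from pU[OF this] tK(2)[OF that] show "p (t i) \<in> U (i - 1)" by blast
    qed
    ultimately show ?thesis using lpc unfolding locally_path_connected_space by blast
  qed
  then have "\<exists>V. \<forall>i\<le>n. openin X (V i) \<and> path_connectedin X (V i) \<and>
      p (t i) \<in> V i \<and> V i \<subseteq> U i \<inter> U (i - 1)"
    by metis
  then obtain V where V: "\<And>i. i \<le> n \<Longrightarrow> openin X (V i)" "\<And>i. i \<le> n \<Longrightarrow> path_connectedin X (V i)"
    "\<And>i. i \<le> n \<Longrightarrow> p (t i) \<in> V i" "\<And>i. i \<le> n \<Longrightarrow> V i \<subseteq> U i \<inter> U (i - 1)"
    by blast
  \<comment> \<open>Singletons are compact, so the positions at the subdivision points are open
    conditions too.\<close>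
  define W where "W = (\<Inter>i\<in>{..n}. {f \<in> loops X x. f ` K i \<subseteq> U i} \<inter>
      {f \<in> loops X x. f ` {t i} \<subseteq> V i})"
  show thesis
  proof
    show "openin (loop_space X x) W"
      unfolding W_def
    proof (intro openin_INT2 openin_Int openin_loop_space_maps_into)
      show "compactin unit_interval_topology (K i)" for i
        by (auto simp: unit_interval_topology_def compactin_subtopology K_def intro: compact_Int_closed)
      show "compactin unit_interval_topology {t i}" if "i \<in> {..n}" for i
        using t01 that by (simp add: unit_interval_topology_def)
    qed (auto simp: oU V(1))
    show "p \<in> W" using p pU V(3) by (simp add: W_def)
    fix q assume q: "q \<in> W"
    then have "q \<in> loops X x" by (auto simp: W_def)
    then have qq: "pathin X q" "q 0 = x" "q 1 = x" by (simp_all add: in_loops_iff)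
    have qU: "q ` K i \<subseteq> U i" and qV: "q (t i) \<in> V i" if "i \<le> n" for i
      using q that by (auto simp: W_def)
    \<comment> \<open>Only for \<open>i = n\<close> does the intersection with \<open>{0..1}\<close>
      cut anything off.\<close>
    have K: "{t i..t (Suc i)} = K i" if "i < n" for i
      using t01[of i] t01[of "Suc i"] that by (auto simp: K_def)
    show "lasso_rel X \<U> x p q"
    proof (rule lasso_rel_of_close_paths[of n, folded t_def])
      show "p ` {t i..t (Suc i)} \<subseteq> U i" "q ` {t i..t (Suc i)} \<subseteq> U i" if "i < n" for i
        using pU[of i] qU[of i] K[OF that] that by simp_all
      show "V i \<subseteq> U i" if "i \<le> n" for i using V(4)[OF that] by blast
      show "V (Suc i) \<subseteq> U i" if "i < n" for i using V(4)[of "Suc i"] that by auto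
    qed (use n pp qq U V qV in auto)
  qed
qed

section \<open>Coset topologies against the topologies of the fundamental group\<close>

lemma coset_topology_coarser_pi1_qtop:
  assumes x: "x \<in> topspace X" and lpc: "locally_path_connected_space X" and \<U>: "open_cover X \<U>"
  shows "coarser_topology (coset_topology (fundamental_group X x) (lasso_group X \<U> x)) (pi1_qtop X x)"
  unfolding coarser_topology_def
proof (intro conjI allI impI)
  let ?G = "fundamental_group X x" and ?N = "lasso_group X \<U> x"
  show "topspace (coset_topology ?G ?N) = topspace (pi1_qtop X x)"
    by (simp add: topspace_pi1_qtop)
  fix W assume "openin (coset_topology ?G ?N) W"
  then obtain \<C> where W: "W = {a \<in> carrier ?G. ?N #>\<^bsub>?G\<^esub> a \<in> \<C>}"
    by (auto simp: openin_coset_topology)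
  have "openin (loop_space X x) {p \<in> loops X x. loop_class X x p \<in> W}"
  proof (subst openin_subopen, intro ballI)
    fix p assume p: "p \<in> {p \<in> loops X x. loop_class X x p \<in> W}"
    then obtain Q where Q: "openin (loop_space X x) Q" "p \<in> Q" "\<And>q. q \<in> Q \<Longrightarrow> lasso_rel X \<U> x p q"
      using lasso_rel_neighbourhood[OF lpc \<U>] by blast
    have "q \<in> loops X x \<and> loop_class X x q \<in> W" if "q \<in> Q" for q
    proof
      show q: "q \<in> loops X x"
        using that openin_subset[OF Q(1)] by (auto simp: topspace_loop_space)
      show "loop_class X x q \<in> W"
        using coset_eq_of_lasso_rel[OF x _ q Q(3)[OF that]] p q by (simp add: W carrier_fundamental_group)
    qed
    then show "\<exists>T. openin (loop_space X x) T \<and> p \<in> T \<and> T \<subseteq> {p \<in> loops X x. loop_class X x p \<in> W}"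
      using Q by blast
  qed
  moreover have "W \<subseteq> loop_class X x ` loops X x"
    by (auto simp: W carrier_fundamental_group)
  ultimately show "openin (pi1_qtop X x) W"
    by (simp add: pi1_qtop_def openin_quotient_topology topspace_loop_space)
qed

theorem corollary5p9:
  fixes X :: "'a topology" and x :: 'a
  assumes "connected_space X"
    and "locally_path_connected_space X"
    and "paracompact_space X"
    and "x \<in> topspace X"
    and "spanier_group X x = {\<one>\<^bsub>fundamental_group X x\<^esub>}"
  shows "Hausdorff_space (pi1_tau X x)"
proof -
  let ?G = "fundamental_group X x"
  interpret group ?G using assms(4) by (rule group_fundamental_group)
  \<comment> \<open>\<open>pi1_tau\<close> is a definite description; unique existence is what gives
    access to its defining property.\<close>
  have finest: "is_finest_group_topology ?G (pi1_qtop X x) (pi1_tau X x)"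
    unfolding pi1_tau_def finest_group_topology_def
    by (rule theI'[OF ex1_finest_group_topology[OF is_group topspace_pi1_qtop]])
  then have top: "topspace (pi1_tau X x) = carrier ?G"
    by (simp add: is_finest_group_topology_def topological_group_def)
  show ?thesis
    unfolding Hausdorff_space_def
  proof (intro allI impI, elim conjE)
    fix a b assume "a \<in> topspace (pi1_tau X x)" "b \<in> topspace (pi1_tau X x)" and ne: "a \<noteq> b"
    then have ab: "a \<in> carrier ?G" "b \<in> carrier ?G" by (simp_all add: top)
    have "a \<otimes>\<^bsub>?G\<^esub> inv\<^bsub>?G\<^esub> b \<noteq> \<one>\<^bsub>?G\<^esub>"
      using ab ne by (metis inv_equality inv_inv inv_closed)
    then have "a \<otimes>\<^bsub>?G\<^esub> inv\<^bsub>?G\<^esub> b \<notin> spanier_group X x"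
      using assms(5) by simp
    then obtain \<U> where \<U>: "open_cover X \<U>" "a \<otimes>\<^bsub>?G\<^esub> inv\<^bsub>?G\<^esub> b \<notin> spanier_group_of_cover X \<U> x"
      by (auto simp: spanier_group_def)
    define N where "N = lasso_group X \<U> x"
    interpret normal N ?G unfolding N_def using assms(4) by (rule normal_lasso_group)
    let ?T = "coset_topology ?G N"
    have notin: "a \<otimes>\<^bsub>?G\<^esub> inv\<^bsub>?G\<^esub> b \<notin> N"
      using \<U>(2) lasso_group_subset_spanier_group_of_cover[OF assms(4)] by (auto simp: N_def)
    \<comment> \<open>\<open>?T\<close> is one of the group topologies over which pi_1^tau is
      finest, so every union of cosets of \<open>N\<close> is open in it.\<close>
    have "coarser_topology ?T (pi1_tau X x)"
      using finest coset_topology_coarser_pi1_qtop[OF assms(4,2) \<U>(1)]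
        topological_group_coset_topology[OF normal_axioms]
      by (simp add: is_finest_group_topology_def N_def)
    moreover define C where "C d = {c \<in> carrier ?G. N #>\<^bsub>?G\<^esub> c = N #>\<^bsub>?G\<^esub> d}" for d
    have "openin ?T (C d)" for d
      unfolding openin_coset_topology C_def by (rule exI[of _ "{N #>\<^bsub>?G\<^esub> d}"]) simp
    ultimately have op: "openin (pi1_tau X x) (C d)" for d
      by (simp add: coarser_topology_def)
    \<comment> \<open>Equal cosets would put \<open>a b^-1\<close> into \<open>N\<close>, hence into
      the Spanier group of the chosen cover.\<close>
    have "N #>\<^bsub>?G\<^esub> a \<noteq> N #>\<^bsub>?G\<^esub> b"
    proof
      assume "N #>\<^bsub>?G\<^esub> a = N #>\<^bsub>?G\<^esub> b"
      then have "a \<in> N #>\<^bsub>?G\<^esub> b"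
        using ab is_subgroup rcos_self by metis
      then show False
        using notin ab rcos_module_imp[OF is_group] by blast
    qed
    then have "disjnt (C a) (C b)"
      by (simp add: C_def disjnt_iff)
    moreover have "a \<in> C a" "b \<in> C b"
      using ab by (simp_all add: C_def)
    ultimately show "\<exists>U V. openin (pi1_tau X x) U \<and> openin (pi1_tau X x) V \<and> a \<in> U \<and> b \<in> V \<and> disjnt U V"
      using op by blast
  qed
qed

end
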